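(* An extension $A\subset E$ of unital associative algebras over a field $k$ has a retraction that is an $A$-bimodule map if and only if there exists an isomorphism of algebras $E\cong A\#^f V$, where $A\#^f V$ is a cocycle semidirect product of algebras (associated to some cocycle semidirect system $\Omega(A,V)=(\triangleleft,\rightharpoonup,f,\cdot)$ of $A$ and a vector space $V$).
   Context: All vector spaces, linear and bilinear maps are over an arbitrary field $k$. "Algebra" means unital associative $k$-algebra; algebra maps preserve units; modules are unital. For an inclusion of algebras $A\subset E$, $E$ is an $A$-bimodule by multiplication in $E$. A retraction is a linear map $p:E\to A$ with $p(a)=a$ for all $a\in A$. A cocycle semidirect system of algebras $\Omega(A,V)=(\triangleleft,\rightharpoonup,f,\cdot)$ consists of bilinear maps $\triangleleft:V\times A\to V$, $\rightharpoonup:A\times V\to V$, $f:V\times V\to A$, $\cdot:V\times V\to V$ such that $(V,\rightharpoonup,\triangleleft)$ is an $A$-bimodule (left action $\rightharpoonup$, right action $\triangleleft$), $f$ is an $A$-balanced $A$-bimodule map, i.e. $f(x,a\rightharpoonup y)=f(x\triangleleft a,y)$, $f(a\rightharpoonup x,y)=a\,f(x,y)$, $f(x,y\triangleleft a)=f(x,y)\,a$, and for all $a\in A$, $x,y,z\in V$: $x\cdot(y\cdot z)-(x\cdot y)\cdot z=f(x,y)\rightharpoonup z-x\triangleleft f(y,z)$; $a\rightharpoonup(x\cdot y)=(a\rightharpoonup x)\cdot y$; $(x\cdot y)\triangleleft a=x\cdot(y\triangleleft a)$; $x\cdot(a\rightharpoonup y)=(x\triangleleft a)\cdot y$; $f(x,y\cdot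 z)=f(x\cdot y,z)$. The cocycle semidirect product $A\#^f V$ is the vector space $A\times V$ with the (associative, with unit $(1_A,0)$) multiplication $$(a,x)\bullet(b,y)=\bigl(ab+f(x,y),\ a\rightharpoonup y+x\triangleleft b+x\cdot y\bigr).$$
   Formalization: The isomorphism of algebras E ≅ A#^f V is required to be the identity on A, sending each a in A to (a,0); for an abstract isomorphism the "if" direction fails, e.g. for k[x,xy] ⊂ k[x,y] with V = 0. *)

theory Defs
  imports "HOL-Algebra.Module" "HOL-Algebra.Subrings" "HOL-Algebra.QuotRing"
begin

(* A record of type module carries both a ring structure and a scalar multiplication, so it is
   used for (unital associative, not necessarily commutative) K-algebras; the library's locale
   algebra is restricted to commutative ones. For a mere vector space (locale vector_space_over)
   the fields mult and one of the record are junk and are never referred to. *)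

locale vector_space_over = field K + module K V for K (structure) and V (structure)

locale unital_algebra = vector_space_over K E + E: ring E for K (structure) and E (structure) +
  assumes smult_mult_left:
      "\<lbrakk>c \<in> carrier K; x \<in> carrier E; y \<in> carrier E\<rbrakk>
        \<Longrightarrow> (c \<odot>\<^bsub>E\<^esub> x) \<otimes>\<^bsub>E\<^esub> y = c \<odot>\<^bsub>E\<^esub> (x \<otimes>\<^bsub>E\<^esub> y)"
    and smult_mult_right:
      "\<lbrakk>c \<in> carrier K; x \<in> carrier E; y \<in> carrier E\<rbrakk>
        \<Longrightarrow> x \<otimes>\<^bsub>E\<^esub> (c \<odot>\<^bsub>E\<^esub> y) = c \<odot>\<^bsub>E\<^esub> (x \<otimes>\<^bsub>E\<^esub> y)"

(* A is a unital subalgebra of E; as an algebra in its own right it is E\<lparr>carrier := A\<rparr>. *)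
locale algebra_extension = unital_algebra K E + subring A E + submodule A K E
  for K (structure) and A and E (structure)

definition linear_map ::
  "('k, 'r) ring_scheme \<Rightarrow> ('k, 'v, 'm) module_scheme \<Rightarrow> ('k, 'w, 'n) module_scheme
    \<Rightarrow> ('v \<Rightarrow> 'w) \<Rightarrow> bool"
where
  "linear_map K V W g \<longleftrightarrow>
     g \<in> carrier V \<rightarrow> carrier W \<and>
     (\<forall>x \<in> carrier V. \<forall>y \<in> carrier V. g (x \<oplus>\<^bsub>V\<^esub> y) = g x \<oplus>\<^bsub>W\<^esub> g y) \<and>
     (\<forall>c \<in> carrier K. \<forall>x \<in> carrier V. g (c \<odot>\<^bsub>V\<^esub> x) = c \<odot>\<^bsub>W\<^esub> g x)"

definition bilinear_map ::
  "('k, 'r) ring_scheme \<Rightarrow> ('k, 'u, 'l) module_scheme \<Rightarrow> ('k, 'v, 'm) module_scheme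
    \<Rightarrow> ('k, 'w, 'n) module_scheme \<Rightarrow> ('u \<Rightarrow> 'v \<Rightarrow> 'w) \<Rightarrow> bool"
where
  "bilinear_map K U V W g \<longleftrightarrow>
     (\<forall>x \<in> carrier U. linear_map K V W (\<lambda>y. g x y)) \<and>
     (\<forall>y \<in> carrier V. linear_map K U W (\<lambda>x. g x y))"

(* la a x is the left action of a on x, and ra x a the right action. *)
locale algebra_bimodule = A: unital_algebra K A + V: vector_space_over K V
  for K (structure) and A (structure) and V (structure)
    and la and ra +
  assumes la_bilinear: "bilinear_map K A V V la"
    and ra_bilinear: "bilinear_map K V A V ra"
    and la_one: "x \<in> carrier V \<Longrightarrow> la \<one>\<^bsub>A\<^esub> x = x"
    and la_mult: "\<lbrakk>a \<in> carrier A; b \<in> carrier A; x \<in> carrier V\<rbrakk>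
      \<Longrightarrow> la (a \<otimes>\<^bsub>A\<^esub> b) x = la a (la b x)"
    and ra_one: "x \<in> carrier V \<Longrightarrow> ra x \<one>\<^bsub>A\<^esub> = x"
    and ra_mult: "\<lbrakk>a \<in> carrier A; b \<in> carrier A; x \<in> carrier V\<rbrakk>
      \<Longrightarrow> ra x (a \<otimes>\<^bsub>A\<^esub> b) = ra (ra x a) b"
    and la_ra: "\<lbrakk>a \<in> carrier A; b \<in> carrier A; x \<in> carrier V\<rbrakk>
      \<Longrightarrow> ra (la a x) b = la a (ra x b)"

definition algebra_retraction ::
  "('k, 'r) ring_scheme \<Rightarrow> 'e set \<Rightarrow> ('k, 'e, 'm) module_scheme \<Rightarrow> ('e \<Rightarrow> 'e) \<Rightarrow> bool"
where
  "algebra_retraction K A E p \<longleftrightarrow> linear_map K E (E\<lparr>carrier := A\<rparr>) p \<and> (\<forall>a \<in> A. p a = a)"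

(* Both E and A are A-bimodules by the multiplication of E. *)
definition bimodule_retraction ::
  "('k, 'r) ring_scheme \<Rightarrow> 'e set \<Rightarrow> ('k, 'e, 'm) module_scheme \<Rightarrow> ('e \<Rightarrow> 'e) \<Rightarrow> bool"
where
  "bimodule_retraction K A E p \<longleftrightarrow>
     algebra_retraction K A E p \<and>
     (\<forall>a \<in> A. \<forall>x \<in> carrier E. p (a \<otimes>\<^bsub>E\<^esub> x) = a \<otimes>\<^bsub>E\<^esub> p x) \<and>
     (\<forall>a \<in> A. \<forall>x \<in> carrier E. p (x \<otimes>\<^bsub>E\<^esub> a) = p x \<otimes>\<^bsub>E\<^esub> a)"

(* The parameters ra, la, f, mu are the maps of the system in the order (right action, left action,
   cocycle, multiplication of V); mu is in general neither associative nor unital. *)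
locale cocycle_semidirect_system = algebra_bimodule K A V la ra
  for K (structure) and A (structure) and V (structure)
    and ra and la and f and mu +
  assumes f_bilinear: "bilinear_map K V V A f"
    and mu_bilinear: "bilinear_map K V V V mu"
    and f_balanced: "\<lbrakk>a \<in> carrier A; x \<in> carrier V; y \<in> carrier V\<rbrakk>
      \<Longrightarrow> f x (la a y) = f (ra x a) y"
    and f_left: "\<lbrakk>a \<in> carrier A; x \<in> carrier V; y \<in> carrier V\<rbrakk>
      \<Longrightarrow> f (la a x) y = a \<otimes>\<^bsub>A\<^esub> f x y"
    and f_right: "\<lbrakk>a \<in> carrier A; x \<in> carrier V; y \<in> carrier V\<rbrakk>
      \<Longrightarrow> f x (ra y a) = f x y \<otimes>\<^bsub>A\<^esub> a"
    and mu_assoc: "\<lbrakk>x \<in> carrier V; y \<in> carrier V; z \<in> carrier V\<rbrakk>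
      \<Longrightarrow> mu x (mu y z) \<ominus>\<^bsub>V\<^esub> mu (mu x y) z = la (f x y) z \<ominus>\<^bsub>V\<^esub> ra x (f y z)"
    and mu_left: "\<lbrakk>a \<in> carrier A; x \<in> carrier V; y \<in> carrier V\<rbrakk>
      \<Longrightarrow> la a (mu x y) = mu (la a x) y"
    and mu_right: "\<lbrakk>a \<in> carrier A; x \<in> carrier V; y \<in> carrier V\<rbrakk>
      \<Longrightarrow> ra (mu x y) a = mu x (ra y a)"
    and mu_balanced: "\<lbrakk>a \<in> carrier A; x \<in> carrier V; y \<in> carrier V\<rbrakk>
      \<Longrightarrow> mu x (la a y) = mu (ra x a) y"
    and f_mu: "\<lbrakk>x \<in> carrier V; y \<in> carrier V; z \<in> carrier V\<rbrakk>
      \<Longrightarrow> f x (mu y z) = f (mu x y) z"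

definition cocycle_semidirect_product ::
  "('k, 'a, 'm) module_scheme \<Rightarrow> ('k, 'v, 'n) module_scheme \<Rightarrow> ('v \<Rightarrow> 'a \<Rightarrow> 'v)
    \<Rightarrow> ('a \<Rightarrow> 'v \<Rightarrow> 'v) \<Rightarrow> ('v \<Rightarrow> 'v \<Rightarrow> 'a) \<Rightarrow> ('v \<Rightarrow> 'v \<Rightarrow> 'v) \<Rightarrow> ('k, 'a \<times> 'v) module"
where
  "cocycle_semidirect_product A V ra la f mu =
     \<lparr>carrier = carrier A \<times> carrier V,
      mult = (\<lambda>(a, x) (b, y). (a \<otimes>\<^bsub>A\<^esub> b \<oplus>\<^bsub>A\<^esub> f x y, la a y \<oplus>\<^bsub>V\<^esub> ra x b \<oplus>\<^bsub>V\<^esub> mu x y)),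
      one = (\<one>\<^bsub>A\<^esub>, \<zero>\<^bsub>V\<^esub>),
      zero = (\<zero>\<^bsub>A\<^esub>, \<zero>\<^bsub>V\<^esub>),
      add = (\<lambda>(a, x) (b, y). (a \<oplus>\<^bsub>A\<^esub> b, x \<oplus>\<^bsub>V\<^esub> y)),
      smult = (\<lambda>c (a, x). (c \<odot>\<^bsub>A\<^esub> a, c \<odot>\<^bsub>V\<^esub> x))\<rparr>"

definition algebra_iso ::
  "('k, 'r) ring_scheme \<Rightarrow> ('k, 'a, 'm) module_scheme \<Rightarrow> ('k, 'b, 'n) module_scheme
    \<Rightarrow> ('a \<Rightarrow> 'b) set"
where
  "algebra_iso K E F = {h \<in> ring_iso E F. linear_map K E F h}"

(* An isomorphism from E onto the cocycle semidirect product as extensions of A, i.e. one that is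
   the identity on A, where A sits in the product as the pairs (a, 0). An isomorphism of abstract
   algebras that forgets A would not do: for E = k[x, y], A = k[x, xy] and V = 0 the algebras E and A
   are isomorphic, but A has no A-linear retraction p in E, as x p(y) = p(xy) = xy would force
   p(y) = y. *)
definition cocycle_semidirect_iso ::
  "('k, 'r) ring_scheme \<Rightarrow> 'e set \<Rightarrow> ('k, 'e, 'm) module_scheme \<Rightarrow> ('k, 'v, 'n) module_scheme
    \<Rightarrow> ('v \<Rightarrow> 'e \<Rightarrow> 'v) \<Rightarrow> ('e \<Rightarrow> 'v \<Rightarrow> 'v) \<Rightarrow> ('v \<Rightarrow> 'v \<Rightarrow> 'e) \<Rightarrow> ('v \<Rightarrow> 'v \<Rightarrow> 'v)
    \<Rightarrow> ('e \<Rightarrow> 'e \<times> 'v) \<Rightarrow> bool"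
where
  "cocycle_semidirect_iso K A E V ra la f mu \<phi> \<longleftrightarrow>
     \<phi> \<in> algebra_iso K E (cocycle_semidirect_product (E\<lparr>carrier := A\<rparr>) V ra la f mu) \<and>
     (\<forall>a \<in> A. \<phi> a = (a, \<zero>\<^bsub>V\<^esub>))"

end

theory Submission
  imports Defs
begin

text \<open>
  A bimodule retraction \<open>p\<close> splits \<open>E\<close> as \<open>A \<oplus> V\<close> with \<open>V = ker p\<close>, and
  \<open>V\<close> is a subbimodule of \<open>E\<close>. Only the product of two elements of \<open>V\<close> leaves \<open>V\<close>: its
  component \<open>p (x y)\<close> in \<open>A\<close> is the cocycle and its component \<open>x y - p (x y)\<close> in
  \<open>V\<close> is the multiplication of \<open>V\<close>. Conversely, the first projection of a cocycle semidirect product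
  is a bimodule map, since \<open>(a, 0) \<bullet> (b, y) = (a b, a \<rightharpoonup> y)\<close>, and symmetrically on the right.
\<close>

section \<open>Arithmetic of differences and of bilinear maps\<close>

lemma (in abelian_group) add_diff_add:
  "\<lbrakk>x \<in> carrier G; y \<in> carrier G; z \<in> carrier G; w \<in> carrier G\<rbrakk>
    \<Longrightarrow> (x \<oplus> y) \<ominus> (z \<oplus> w) = (x \<ominus> z) \<oplus> (y \<ominus> w)"
  by (simp add: a_minus_def minus_add a_ac)

lemma (in abelian_group) diff_diff_cancel_left:
  assumes "x \<in> carrier G" "y \<in> carrier G" "z \<in> carrier G"
  shows "(x \<ominus> y) \<ominus> (x \<ominus> z) = z \<ominus> y"
proof -
  have "(x \<ominus> y) \<ominus> (x \<ominus> z) = (x \<oplus> \<ominus> x) \<oplus> (z \<ominus> y)"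
    using assms by (simp add: a_minus_def minus_add a_ac)
  then show ?thesis
    using assms by (simp add: r_neg)
qed

lemma (in abelian_group) diff_diff_cancel_right:
  assumes "x \<in> carrier G" "y \<in> carrier G" "z \<in> carrier G"
  shows "(y \<ominus> x) \<ominus> (z \<ominus> x) = y \<ominus> z"
proof -
  have "(y \<ominus> x) \<ominus> (z \<ominus> x) = (x \<oplus> \<ominus> x) \<oplus> (y \<ominus> z)"
    using assms by (simp add: a_minus_def minus_add a_ac)
  then show ?thesis
    using assms by (simp add: r_neg)
qed

lemma (in abelian_group) add_diff_cancel:
  assumes "x \<in> carrier G" "y \<in> carrier G"
  shows "x \<oplus> (y \<ominus> x) = y"
proof -
  have "x \<oplus> (y \<ominus> x) = y \<oplus> (x \<oplus> \<ominus> x)"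
    using assms by (simp add: a_minus_def a_ac)
  then show ?thesis
    using assms by (simp add: r_neg)
qed

lemma (in abelian_group) diff_self [simp]: "x \<in> carrier G \<Longrightarrow> x \<ominus> x = \<zero>"
  by (simp add: a_minus_def r_neg)

lemma (in abelian_group) diff_zero [simp]: "x \<in> carrier G \<Longrightarrow> x \<ominus> \<zero> = x"
  by (simp add: a_minus_def)

lemma (in ring) diff_mult:
  "\<lbrakk>x \<in> carrier R; y \<in> carrier R; z \<in> carrier R\<rbrakk>
    \<Longrightarrow> (x \<ominus> y) \<otimes> z = x \<otimes> z \<ominus> y \<otimes> z"
  by (simp add: a_minus_def l_distr l_minus)

lemma (in ring) mult_diff:
  "\<lbrakk>x \<in> carrier R; y \<in> carrier R; z \<in> carrier R\<rbrakk>
    \<Longrightarrow> x \<otimes> (y \<ominus> z) = x \<otimes> y \<ominus> x \<otimes> z"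
  by (simp add: a_minus_def r_distr r_minus)

lemma (in module) smult_minus_distrib:
  "\<lbrakk>c \<in> carrier R; x \<in> carrier M; y \<in> carrier M\<rbrakk>
    \<Longrightarrow> c \<odot>\<^bsub>M\<^esub> (x \<ominus>\<^bsub>M\<^esub> y) = c \<odot>\<^bsub>M\<^esub> x \<ominus>\<^bsub>M\<^esub> c \<odot>\<^bsub>M\<^esub> y"
  by (simp add: a_minus_def smult_r_distr smult_r_minus)

text \<open>Homogeneity alone suffices: the zero vector is the zero scalar times itself, and that
  scalar moves out of \<open>g\<close>. The deleted simp rules would collapse this product before
  homogeneity could act on it.\<close>

lemma bilinear_map_zero:
  assumes "bilinear_map K U V W g" "module K U" "module K V" "module K W"
  shows "y \<in> carrier V \<Longrightarrow> g \<zero>\<^bsub>U\<^esub> y = \<zero>\<^bsub>W\<^esub>"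
    and "x \<in> carrier U \<Longrightarrow> g x \<zero>\<^bsub>V\<^esub> = \<zero>\<^bsub>W\<^esub>"
proof -
  interpret U: module K U by fact
  interpret V: module K V by fact
  interpret W: module K W by fact
  show "g \<zero>\<^bsub>U\<^esub> y = \<zero>\<^bsub>W\<^esub>" if "y \<in> carrier V"
  proof -
    have "g (\<zero>\<^bsub>K\<^esub> \<odot>\<^bsub>U\<^esub> \<zero>\<^bsub>U\<^esub>) y = \<zero>\<^bsub>K\<^esub> \<odot>\<^bsub>W\<^esub> g \<zero>\<^bsub>U\<^esub> y" "g \<zero>\<^bsub>U\<^esub> y \<in> carrier W"
      using assms(1) that by (auto simp: bilinear_map_def linear_map_def simp del: U.smult_r_null U.smult_l_null)
    then show ?thesis by simp
  qed
  show "g x \<zero>\<^bsub>V\<^esub> = \<zero>\<^bsub>W\<^esub>" if "x \<in> carrier U"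
  proof -
    have "g x (\<zero>\<^bsub>K\<^esub> \<odot>\<^bsub>V\<^esub> \<zero>\<^bsub>V\<^esub>) = \<zero>\<^bsub>K\<^esub> \<odot>\<^bsub>W\<^esub> g x \<zero>\<^bsub>V\<^esub>" "g x \<zero>\<^bsub>V\<^esub> \<in> carrier W"
      using assms(1) that by (auto simp: bilinear_map_def linear_map_def simp del: V.smult_r_null V.smult_l_null)
    then show ?thesis by simp
  qed
qed

lemma (in algebra_extension) subalgebra_unital_algebra: "unital_algebra K (E\<lparr>carrier := A\<rparr>)"
proof -
  have sub: "A \<subseteq> carrier E"
    using subringE(1)[OF subring_axioms] .
  interpret S: module K "E\<lparr>carrier := A\<rparr>"
    by (rule submodule_is_module) (rule module_axioms)
  interpret T: ring "E\<lparr>carrier := A\<rparr>"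
    by (rule E.subring_is_ring) (rule subring_axioms)
  show ?thesis
    by unfold_locales (use sub smult_mult_left smult_mult_right in auto)
qed

section \<open>The splitting of \<open>E\<close> given by a bimodule retraction\<close>

locale retracted_extension = algebra_extension K A E
  for K (structure) and A and E (structure) +
  fixes p
  assumes retraction: "bimodule_retraction K A E p"
begin

lemma A_carrier [simp]: "a \<in> A \<Longrightarrow> a \<in> carrier E"
  using subringE(1)[OF subring_axioms] by blast

lemmas A_closed [simp] = subringE(2,5-)[OF subring_axioms]

lemma p_closed [simp]: "x \<in> carrier E \<Longrightarrow> p x \<in> A"
  and p_add [simp]:
    "\<lbrakk>x \<in> carrier E; y \<in> carrier E\<rbrakk> \<Longrightarrow> p (x \<oplus>\<^bsub>E\<^esub> y) = p x \<oplus>\<^bsub>E\<^esub> p y"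
  and p_smult [simp]:
    "\<lbrakk>c \<in> carrier K; x \<in> carrier E\<rbrakk> \<Longrightarrow> p (c \<odot>\<^bsub>E\<^esub> x) = c \<odot>\<^bsub>E\<^esub> p x"
  and p_id [simp]: "a \<in> A \<Longrightarrow> p a = a"
  and p_left [simp]:
    "\<lbrakk>a \<in> A; x \<in> carrier E\<rbrakk> \<Longrightarrow> p (a \<otimes>\<^bsub>E\<^esub> x) = a \<otimes>\<^bsub>E\<^esub> p x"
  and p_right [simp]:
    "\<lbrakk>a \<in> A; x \<in> carrier E\<rbrakk> \<Longrightarrow> p (x \<otimes>\<^bsub>E\<^esub> a) = p x \<otimes>\<^bsub>E\<^esub> a"
  using retraction
  unfolding bimodule_retraction_def algebra_retraction_def linear_map_def by auto

lemma p_minus [simp]: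
  assumes "x \<in> carrier E"
  shows "p (\<ominus>\<^bsub>E\<^esub> x) = \<ominus>\<^bsub>E\<^esub> p x"
proof -
  have "p (\<ominus>\<^bsub>E\<^esub> x) \<oplus>\<^bsub>E\<^esub> p x = \<zero>\<^bsub>E\<^esub>"
    using assms by (simp flip: p_add add: M.l_neg)
  then show ?thesis
    using assms by (simp add: M.minus_equality)
qed

text \<open>The multiplication and unit of this record are junk, as only its vector space structure is used.\<close>

definition kernel_space where
  "kernel_space = \<lparr>carrier = {x \<in> carrier E. p x = \<zero>\<^bsub>E\<^esub>}, mult = mult E, one = one E,
     zero = zero E, add = add E, smult = smult E\<rparr>"

definition kernel_mult where
  "kernel_mult x y = x \<otimes>\<^bsub>E\<^esub> y \<ominus>\<^bsub>E\<^esub> p (x \<otimes>\<^bsub>E\<^esub> y)"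

text \<open>The second component lies in the kernel because \<open>p x\<close> is in
  \<open>A\<close>, where \<open>p\<close> is the identity.\<close>

definition splitting where
  "splitting x = (p x, x \<ominus>\<^bsub>E\<^esub> p x)"

lemma kernel_space_simps [simp]:
  "x \<in> carrier kernel_space \<longleftrightarrow> x \<in> carrier E \<and> p x = \<zero>\<^bsub>E\<^esub>"
  "zero kernel_space = zero E"
  "add kernel_space = add E"
  "smult kernel_space = smult E"
  by (auto simp: kernel_space_def)

lemma kernel_vector_space: "vector_space_over K kernel_space"
proof -
  have "\<exists>y \<in> carrier kernel_space. y \<oplus>\<^bsub>kernel_space\<^esub> x = \<zero>\<^bsub>kernel_space\<^esub>"
    if "x \<in> carrier kernel_space" for x
    using that by (intro bexI[of _ "\<ominus>\<^bsub>E\<^esub> x"]) (auto simp: M.l_neg)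
  then interpret V: abelian_group kernel_space
    by (intro abelian_groupI) (auto simp: M.a_ac)
  show ?thesis
    by unfold_locales (auto simp: smult_l_distr smult_r_distr smult_assoc1)
qed

text \<open>Negation is not a record field: it is defined by a description over the carrier, so
  shrinking the carrier might change it. Uniqueness of inverses shows that it does not.\<close>

lemma kernel_minus [simp]:
  assumes "x \<in> carrier E" "y \<in> carrier E" "p x = \<zero>\<^bsub>E\<^esub>" "p y = \<zero>\<^bsub>E\<^esub>"
  shows "x \<ominus>\<^bsub>kernel_space\<^esub> y = x \<ominus>\<^bsub>E\<^esub> y"
proof -
  interpret V: vector_space_over K kernel_space
    by (rule kernel_vector_space)
  have "\<ominus>\<^bsub>kernel_space\<^esub> y = \<ominus>\<^bsub>E\<^esub> y"
    by (rule V.minus_equality) (use assms in \<open>auto simp: M.l_neg\<close>)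
  then show ?thesis
    by (simp add: a_minus_def)
qed

lemma p_diff [simp]:
  "\<lbrakk>x \<in> carrier E; y \<in> carrier E\<rbrakk> \<Longrightarrow> p (x \<ominus>\<^bsub>E\<^esub> y) = p x \<ominus>\<^bsub>E\<^esub> p y"
  by (simp add: a_minus_def)

text \<open>Associativity as a simp rule nests products to the right and hides the factor
  \<open>a\<close> from \<open>p_right\<close>; this restores access to it.\<close>

lemma p_mult_right:
  "\<lbrakk>a \<in> A; x \<in> carrier E; y \<in> carrier E\<rbrakk>
    \<Longrightarrow> p (x \<otimes>\<^bsub>E\<^esub> (y \<otimes>\<^bsub>E\<^esub> a)) = p (x \<otimes>\<^bsub>E\<^esub> y) \<otimes>\<^bsub>E\<^esub> a"
  by (simp flip: E.m_assoc)

text \<open>This computes the cocycle on the kernel parts of \<open>x\<close> and \<open>y\<close>.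
  The product of \<open>p x\<close> with the kernel part of \<open>y\<close> is killed by
  \<open>p\<close>, and \<open>p\<close> sends \<open>x\<close> times \<open>p y\<close> to
  \<open>p x\<close> times \<open>p y\<close>.\<close>

lemma p_mult_diff:
  assumes "x \<in> carrier E" "y \<in> carrier E"
  shows "p ((x \<ominus>\<^bsub>E\<^esub> p x) \<otimes>\<^bsub>E\<^esub> (y \<ominus>\<^bsub>E\<^esub> p y)) = p (x \<otimes>\<^bsub>E\<^esub> y) \<ominus>\<^bsub>E\<^esub> p x \<otimes>\<^bsub>E\<^esub> p y"
proof -
  have "p ((x \<ominus>\<^bsub>E\<^esub> p x) \<otimes>\<^bsub>E\<^esub> (y \<ominus>\<^bsub>E\<^esub> p y)) =
      p (x \<otimes>\<^bsub>E\<^esub> (y \<ominus>\<^bsub>E\<^esub> p y)) \<ominus>\<^bsub>E\<^esub> p x \<otimes>\<^bsub>E\<^esub> p (y \<ominus>\<^bsub>E\<^esub> p y)"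
    using assms by (simp add: E.diff_mult del: p_diff flip: p_left p_diff)
  then show ?thesis
    using assms by (simp add: E.mult_diff)
qed

text \<open>This is the kernel component of multiplicativity. Of the four terms in the expanded
  product, the mixed ones are the two actions, and the product of \<open>p x\<close> and
  \<open>p y\<close> is removed by subtracting \<open>p\<close> of the whole.\<close>

lemma splitting_mult:
  assumes "x \<in> carrier E" "y \<in> carrier E"
  defines "x' \<equiv> x \<ominus>\<^bsub>E\<^esub> p x" and "y' \<equiv> y \<ominus>\<^bsub>E\<^esub> p y"
  shows "x \<otimes>\<^bsub>E\<^esub> y \<ominus>\<^bsub>E\<^esub> p (x \<otimes>\<^bsub>E\<^esub> y) =
    p x \<otimes>\<^bsub>E\<^esub> y' \<oplus>\<^bsub>E\<^esub> x' \<otimes>\<^bsub>E\<^esub> p y \<oplus>\<^bsub>E\<^esub> (x' \<otimes>\<^bsub>E\<^esub> y' \<ominus>\<^bsub>E\<^esub> p (x' \<otimes>\<^bsub>E\<^esub> y'))"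
proof -
  have c: "x' \<in> carrier E" "y' \<in> carrier E"
    using assms by auto
  have xy: "x = x' \<oplus>\<^bsub>E\<^esub> p x" "y = y' \<oplus>\<^bsub>E\<^esub> p y"
    using assms by (simp_all add: a_minus_def M.a_assoc M.l_neg)
  have "x \<otimes>\<^bsub>E\<^esub> y = (x' \<oplus>\<^bsub>E\<^esub> p x) \<otimes>\<^bsub>E\<^esub> (y' \<oplus>\<^bsub>E\<^esub> p y)"
    using xy by simp
  also have "\<dots> = p x \<otimes>\<^bsub>E\<^esub> y' \<oplus>\<^bsub>E\<^esub> x' \<otimes>\<^bsub>E\<^esub> p y \<oplus>\<^bsub>E\<^esub> x' \<otimes>\<^bsub>E\<^esub> y' \<oplus>\<^bsub>E\<^esub> p x \<otimes>\<^bsub>E\<^esub> p y"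
    using assms(1,2) c by (simp add: E.l_distr E.r_distr M.a_ac)
  finally have eq: "x \<otimes>\<^bsub>E\<^esub> y =
    p x \<otimes>\<^bsub>E\<^esub> y' \<oplus>\<^bsub>E\<^esub> x' \<otimes>\<^bsub>E\<^esub> p y \<oplus>\<^bsub>E\<^esub> x' \<otimes>\<^bsub>E\<^esub> y' \<oplus>\<^bsub>E\<^esub> p x \<otimes>\<^bsub>E\<^esub> p y" .
  have p_eq: "p (x \<otimes>\<^bsub>E\<^esub> y) = p (x' \<otimes>\<^bsub>E\<^esub> y') \<oplus>\<^bsub>E\<^esub> p x \<otimes>\<^bsub>E\<^esub> p y"
    using assms p_mult_diff by (simp add: a_minus_def M.a_assoc M.l_neg)
  have "x \<otimes>\<^bsub>E\<^esub> y \<ominus>\<^bsub>E\<^esub> p (x \<otimes>\<^bsub>E\<^esub> y) =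
      p x \<otimes>\<^bsub>E\<^esub> y' \<oplus>\<^bsub>E\<^esub> x' \<otimes>\<^bsub>E\<^esub> p y \<oplus>\<^bsub>E\<^esub> x' \<otimes>\<^bsub>E\<^esub> y' \<ominus>\<^bsub>E\<^esub> p (x' \<otimes>\<^bsub>E\<^esub> y')"
    \<comment> \<open>The regrouping pairs the product of \<open>p x\<close> and \<open>p y\<close>
      with itself, so that it cancels.\<close>
    unfolding p_eq by (subst eq, subst M.add_diff_add) (use assms(1,2) c in simp_all)
  then show ?thesis
    using assms(1,2) c by (simp add: a_minus_def M.a_assoc)
qed

text \<open>For \<open>mu_assoc\<close>, both bracketings contain the term \<open>p\<close> of the
  triple product, which cancels first; then the triple product itself cancels, leaving the two
  action terms. Terms such as \<open>p\<close> of \<open>x\<close> times \<open>p (y z)\<close>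
  vanish since \<open>p x\<close> is zero.\<close>

lemma kernel_system:
  "cocycle_semidirect_system K (E\<lparr>carrier := A\<rparr>) kernel_space (mult E) (mult E)
     (\<lambda>x y. p (x \<otimes>\<^bsub>E\<^esub> y)) kernel_mult"
proof -
  interpret B: unital_algebra K "E\<lparr>carrier := A\<rparr>"
    by (rule subalgebra_unital_algebra)
  interpret V: vector_space_over K kernel_space
    by (rule kernel_vector_space)
  show ?thesis
    by unfold_locales (simp_all add: bilinear_map_def linear_map_def Pi_iff kernel_mult_def
      E.l_distr E.r_distr E.m_assoc smult_mult_left smult_mult_right smult_minus_distrib p_mult_right
      E.diff_mult E.mult_diff M.add_diff_add M.diff_diff_cancel_left M.diff_diff_cancel_right)
qed

text \<open>Multiplicativity is \<open>p_mult_diff\<close> in the first component and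
  \<open>splitting_mult\<close> in the second.\<close>

lemma splitting_iso:
  "cocycle_semidirect_iso K A E kernel_space (mult E) (mult E)
     (\<lambda>x y. p (x \<otimes>\<^bsub>E\<^esub> y)) kernel_mult splitting"
  (is "cocycle_semidirect_iso K A E _ _ _ ?f _ _")
proof -
  let ?P = "cocycle_semidirect_product (E\<lparr>carrier := A\<rparr>) kernel_space (mult E) (mult E) ?f kernel_mult"
  have "splitting \<in> ring_hom E ?P"
    by (rule ring_hom_memI)
      (simp_all add: cocycle_semidirect_product_def splitting_def kernel_mult_def p_mult_diff
        splitting_mult M.add_diff_add M.add_diff_cancel)
  \<comment> \<open>The inverse adds the two components inside \<open>E\<close>.\<close>
  moreover have "bij_betw splitting (carrier E) (carrier ?P)"
    by (rule bij_betw_byWitness[where f' = "\<lambda>(a, x). a \<oplus>\<^bsub>E\<^esub> x"])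
      (auto simp: cocycle_semidirect_product_def splitting_def a_minus_def M.a_ac M.r_neg
        M.add_diff_cancel[unfolded a_minus_def])
  moreover have "linear_map K E ?P splitting"
    by (auto simp: linear_map_def cocycle_semidirect_product_def splitting_def smult_minus_distrib
      M.add_diff_add)
  ultimately show ?thesis
    by (simp add: cocycle_semidirect_iso_def algebra_iso_def ring_iso_def splitting_def)
qed

end

section \<open>From an isomorphism back to a retraction\<close>

lemma cocycle_semidirect_iso_imp_retraction:
  assumes "algebra_extension K A E"
    and "cocycle_semidirect_system K (E\<lparr>carrier := A\<rparr>) V ra la f mu"
    and "cocycle_semidirect_iso K A E V ra la f mu \<phi>"
  shows "bimodule_retraction K A E (fst \<circ> \<phi>)"
proof -
  interpret algebra_extension K A E by fact
  interpret S: cocycle_semidirect_system K "E\<lparr>carrier := A\<rparr>" V ra la f mu by fact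
  let ?P = "cocycle_semidirect_product (E\<lparr>carrier := A\<rparr>) V ra la f mu"
  have hom: "\<phi> \<in> ring_hom E ?P" and lin: "linear_map K E ?P \<phi>"
    and id: "\<And>a. a \<in> A \<Longrightarrow> \<phi> a = (a, \<zero>\<^bsub>V\<^esub>)"
    using assms(3) by (auto simp: cocycle_semidirect_iso_def algebra_iso_def ring_iso_def)
  have sub: "a \<in> carrier E" if "a \<in> A" for a
    using that subringE(1)[OF subring_axioms] by blast
  \<comment> \<open>This removes the cocycle term when one factor of a product is the image
    \<open>(a, 0)\<close> of an element of \<open>A\<close>.\<close>
  have f_zero: "f \<zero>\<^bsub>V\<^esub> y = \<zero>\<^bsub>E\<^esub>" "f y \<zero>\<^bsub>V\<^esub> = \<zero>\<^bsub>E\<^esub>" if "y \<in> carrier V" for y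
    using bilinear_map_zero[OF S.f_bilinear] S.V.module_axioms S.A.module_axioms that by auto
  have fst_in: "fst (\<phi> x) \<in> A" "snd (\<phi> x) \<in> carrier V" if "x \<in> carrier E" for x
    using ring_hom_closed[OF hom that] by (auto simp: cocycle_semidirect_product_def)
  have "fst (\<phi> (a \<otimes>\<^bsub>E\<^esub> x)) = a \<otimes>\<^bsub>E\<^esub> fst (\<phi> x)"
       "fst (\<phi> (x \<otimes>\<^bsub>E\<^esub> a)) = fst (\<phi> x) \<otimes>\<^bsub>E\<^esub> a" if "a \<in> A" "x \<in> carrier E" for a x
    using ring_hom_mult[OF hom] that sub fst_in f_zero
    by (simp_all add: id cocycle_semidirect_product_def split_beta)
  moreover have "linear_map K E (E\<lparr>carrier := A\<rparr>) (fst \<circ> \<phi>)"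
    using lin fst_in by (auto simp: linear_map_def cocycle_semidirect_product_def split_beta)
  ultimately show ?thesis
    by (simp add: bimodule_retraction_def algebra_retraction_def id)
qed

text \<open>HOL cannot quantify existentially over types. The equivalence therefore takes
  \<open>V\<close> over the type of \<open>E\<close>, where the kernel of \<open>p\<close> lives,
  and the second conjunct gives the converse for \<open>V\<close> over an arbitrary type.\<close>

theorem corollary2p6:
  fixes K :: "('k, 'r) ring_scheme" and E :: "('k, 'e, 'm) module_scheme" and A :: "'e set"
  assumes "algebra_extension K A E"
  shows "((\<exists>p. bimodule_retraction K A E p) \<longleftrightarrow>
      (\<exists>(V :: ('k, 'e) module) ra la f mu \<phi>.
         cocycle_semidirect_system K (E\<lparr>carrier := A\<rparr>) V ra la f mu \<and>
         cocycle_semidirect_iso K A E V ra la f mu \<phi>)) \<and>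
    (\<forall>(V :: ('k, 'v) module) ra la f mu \<phi>.
         cocycle_semidirect_system K (E\<lparr>carrier := A\<rparr>) V ra la f mu \<and>
         cocycle_semidirect_iso K A E V ra la f mu \<phi> \<longrightarrow>
         (\<exists>p. bimodule_retraction K A E p))"
proof -
  have "\<exists>(V :: ('k, 'e) module) ra la f mu \<phi>.
      cocycle_semidirect_system K (E\<lparr>carrier := A\<rparr>) V ra la f mu \<and>
      cocycle_semidirect_iso K A E V ra la f mu \<phi>"
    if "bimodule_retraction K A E p" for p
  proof -
    interpret retracted_extension K A E p
      by (intro retracted_extension.intro retracted_extension_axioms.intro assms that)
    show ?thesis
      using kernel_system splitting_iso by blast
  qed
  then show ?thesis
    by (intro conjI iffI allI impI; elim exE conjE)
      (blast intro: cocycle_semidirect_iso_imp_retraction[OF assms])+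
qed

end
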